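(* Let $\eta\in M^1_G(0,T)$. Then $$\lim_{n\rightarrow\infty}\hat{E}\left[\int_0^T\delta_n(s)\eta_s\,ds\right]=0 .$$
   Context: Sublinear expectations. A sublinear expectation on a linear space $\mathcal{H}$ of real functions on a set $\Omega$ containing the constants is a functional $\hat{E}:\mathcal{H}\to\mathbb{R}$ that is monotone, satisfies $\hat{E}(c)=c$ for constants $c$, $\hat{E}(X)-\hat{E}(Y)\le\hat{E}(X-Y)$, and $\hat{E}(\lambda X)=\lambda\hat{E}(X)$ for $\lambda\ge0$. $C_{l,Lip}(\mathbb{R}^n)$ is the set of real continuous $\varphi$ on $\mathbb{R}^n$ with $|\varphi(x)-\varphi(y)|\le C(1+|x|^k+|y|^k)|x-y|$ for some $C,k$ depending on $\varphi$. Random vectors $X_1,X_2$ (possibly on different spaces) are identically distributed, $X_1\sim X_2$, if $\hat{E}_1[\varphi(X_1)]=\hat{E}_2[\varphi(X_2)]$ for all $\varphi\in C_{l,Lip}$. $Y$ is independent to $X$ if $\hat{E}[\varphi(X,Y)]=\hat{E}\big[\hat{E}[\varphi(x,Y)]_{x=X}\big]$ for all $\varphi\in C_{l,Lip}$. A real random variable $X$ is $G$-normal if $aX+b\hat X\sim\sqrt{a^2+b^2}\,X$ for all $a,b\in\mathbb{R}$, where $\hat X$ is an independent copy of $X$. $G$-expectation (dimension one). Fix $T>0$ and $\overline{\sigma}^2>\underline{\sigma}^2\ge0$ (standing assumption). Let $\Omega_T=C_0([0,T];\mathbb{R})$ be the continuous paths starting at $0$, with supremum norm and canonical process $B$, and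 let $\mathcal{H}^0_T=\{\varphi(B_{t_1},\dots,B_{t_n}): n\ge1,\ t_i\in[0,T],\ \varphi\in C_{l,Lip}(\mathbb{R}^n)\}$. The $G$-expectation is the sublinear expectation on $\mathcal{H}^0_T$ defined, for $0=t_0<t_1<\dots<t_m\le T$, by $$\hat{E}[\varphi(B_{t_1}-B_{t_0},\dots,B_{t_m}-B_{t_{m-1}})]=\tilde{E}[\varphi(\sqrt{t_1-t_0}\,\xi_1,\dots,\sqrt{t_m-t_{m-1}}\,\xi_m)],$$ where $\xi_1,\dots,\xi_m$ are identically distributed $G$-normal random variables on a sublinear expectation space $(\tilde\Omega,\tilde{\mathcal{H}},\tilde E)$ with $\tilde E[\xi_1^2]=\overline{\sigma}^2$ and $-\tilde E[-\xi_1^2]=\underline{\sigma}^2$, and $\xi_{i+1}$ is independent to $(\xi_1,\dots,\xi_i)$ for each $i$. (So $\overline{\sigma}^2=\hat{E}(B_1^2)$ and $\underline{\sigma}^2=-\hat{E}(-B_1^2)$.) For $p\ge1$, $L^p_G(\Omega_T)$ is the completion of $\mathcal{H}^0_T$ under $\|\xi\|_{p,G}=(\hat{E}|\xi|^p)^{1/p}$; $\hat{E}$ extends continuously to $L^1_G(\Omega_T)$. Process spaces. $L_{ip}(\Omega_t)$ is the set of $\varphi(B_{t_1},\dots,B_{t_n})$ with $t_i\in[0,t]$ and $\varphi$ bounded Lipschitz. $M^0_G(0,T)$ is the set of processes $\eta_t=\sum_{j=0}^{N-1}\xi_j1_{]t_j,t_{j+1}]}(t)$ for partitions $0=t_0<\dots<t_N=T$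 and $\xi_j\in L_{ip}(\Omega_{t_j})$. $M^1_G(0,T)$ is the completion of $M^0_G(0,T)$ under $\|\eta\|_{M^1_G}=\hat{E}\left[\int_0^T|\eta_s|ds\right]$. For $\eta\in M^1_G(0,T)$, the integral $\int_0^t\eta_s\,ds$ is an element of $L^1_G(\Omega_T)$, obtained by continuous extension from $M^0_G(0,T)$. For $n\in\mathbb{N}$, $n\ge1$, $\delta_n(s)=\sum_{i=0}^{n-1}(-1)^i1_{]\frac{iT}{n},\frac{(i+1)T}{n}]}(s)$ for $s\in[0,T]$. *)

theory Defs
  imports "HOL-Analysis.Analysis" "HOL-Analysis.Abstract_Euclidean_Space"
begin

section \<open>Completion of a pseudometric on a set\<close>

text \<open>
  Points of the completion of \<open>(V, d)\<close> are the classes of \<open>d\<close>-Cauchy sequences in \<open>V\<close>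
  modulo sequences at vanishing distance.
\<close>

definition cauchy_seqs :: "'v set \<Rightarrow> ('v \<Rightarrow> 'v \<Rightarrow> real) \<Rightarrow> (nat \<Rightarrow> 'v) set" where
  "cauchy_seqs V d =
    {X. range X \<subseteq> V \<and> (\<forall>e>0. \<exists>N. \<forall>m\<ge>N. \<forall>n\<ge>N. d (X m) (X n) < e)}"

definition null_rel :: "'v set \<Rightarrow> ('v \<Rightarrow> 'v \<Rightarrow> real) \<Rightarrow> ((nat \<Rightarrow> 'v) \<times> (nat \<Rightarrow> 'v)) set" where
  "null_rel V d =
    {(X, Y). X \<in> cauchy_seqs V d \<and> Y \<in> cauchy_seqs V d \<and> (\<lambda>n. d (X n) (Y n)) \<longlonglongrightarrow> 0}"

definition completion :: "'v set \<Rightarrow> ('v \<Rightarrow> 'v \<Rightarrow> real) \<Rightarrow> (nat \<Rightarrow> 'v) set set" where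
  "completion V d = cauchy_seqs V d // null_rel V d"

text \<open>
  Continuous extension of a map \<open>f : V \<rightarrow> W\<close>, respectively of a functional \<open>f : V \<rightarrow> \<real>\<close>, to the
  completion.  For the 1-Lipschitz \<open>f\<close> used below, the results do not depend on the
  representative; see \<open>completion_map_class\<close> and \<open>completion_functional_class\<close>.
\<close>

definition completion_map ::
  "'w set \<Rightarrow> ('w \<Rightarrow> 'w \<Rightarrow> real) \<Rightarrow> ('v \<Rightarrow> 'w) \<Rightarrow> (nat \<Rightarrow> 'v) set \<Rightarrow> (nat \<Rightarrow> 'w) set" where
  "completion_map W d' f \<xi> = (\<Union>X\<in>\<xi>. null_rel W d' `` {\<lambda>k. f (X k)})"

definition completion_functional :: "('v \<Rightarrow> real) \<Rightarrow> (nat \<Rightarrow> 'v) set \<Rightarrow> real" where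
  "completion_functional f \<xi> = (THE l. \<forall>X\<in>\<xi>. (\<lambda>k. f (X k)) \<longlonglongrightarrow> l)"

definition pseudometric_on :: "'v set \<Rightarrow> ('v \<Rightarrow> 'v \<Rightarrow> real) \<Rightarrow> bool" where
  "pseudometric_on V d \<longleftrightarrow>
    (\<forall>x\<in>V. d x x = 0) \<and> (\<forall>x\<in>V. \<forall>y\<in>V. 0 \<le> d x y \<and> d x y = d y x) \<and>
    (\<forall>x\<in>V. \<forall>y\<in>V. \<forall>z\<in>V. d x z \<le> d x y + d y z)"

lemma cauchy_seqs_in: "X \<in> cauchy_seqs V d \<Longrightarrow> X k \<in> V"
  unfolding cauchy_seqs_def by blast

lemma cauchy_seqsD:
  "X \<in> cauchy_seqs V d \<Longrightarrow> 0 < e \<Longrightarrow> \<exists>N. \<forall>m\<ge>N. \<forall>n\<ge>N. d (X m) (X n) < e"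
  unfolding cauchy_seqs_def by simp

lemma equiv_null_rel:
  assumes "pseudometric_on V d"
  shows "equiv (cauchy_seqs V d) (null_rel V d)"
proof (rule equivI)
  show "null_rel V d \<subseteq> cauchy_seqs V d \<times> cauchy_seqs V d"
    by (auto simp: null_rel_def)
  show "refl_on (cauchy_seqs V d) (null_rel V d)"
  proof (rule refl_onI)
    fix X assume X: "X \<in> cauchy_seqs V d"
    have "(\<lambda>n. d (X n) (X n)) = (\<lambda>n. 0)"
      using assms cauchy_seqs_in[OF X] by (auto simp: pseudometric_on_def)
    with X show "(X, X) \<in> null_rel V d"
      by (simp add: null_rel_def)
  qed
  show "sym (null_rel V d)"
  proof (rule symI)
    fix X Y assume XY: "(X, Y) \<in> null_rel V d"
    have "(\<lambda>n. d (Y n) (X n)) = (\<lambda>n. d (X n) (Y n))"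
    proof
      fix n
      have "X n \<in> V" "Y n \<in> V"
        using XY by (auto simp: null_rel_def intro: cauchy_seqs_in)
      then show "d (Y n) (X n) = d (X n) (Y n)"
        using assms by (simp add: pseudometric_on_def)
    qed
    with XY show "(Y, X) \<in> null_rel V d"
      by (simp add: null_rel_def)
  qed
  show "trans (null_rel V d)"
  proof (rule transI)
    fix X Y Z assume XY: "(X, Y) \<in> null_rel V d" and YZ: "(Y, Z) \<in> null_rel V d"
    have in_V: "X n \<in> V" "Y n \<in> V" "Z n \<in> V" for n
      using XY YZ by (auto simp: null_rel_def intro: cauchy_seqs_in)
    have "(\<lambda>n. d (X n) (Y n) + d (Y n) (Z n)) \<longlonglongrightarrow> 0 + 0"
      using XY YZ by (intro tendsto_add) (auto simp: null_rel_def)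
    then have lim: "(\<lambda>n. d (X n) (Y n) + d (Y n) (Z n)) \<longlonglongrightarrow> 0"
      by simp
    have "0 \<le> d (X n) (Z n)" "d (X n) (Z n) \<le> d (X n) (Y n) + d (Y n) (Z n)" for n
      using assms in_V[of n] by (simp_all add: pseudometric_on_def)
    then have "(\<lambda>n. d (X n) (Z n)) \<longlonglongrightarrow> 0"
      by (intro tendsto_sandwich[OF _ _ tendsto_const lim]) simp_all
    with XY YZ show "(X, Z) \<in> null_rel V d"
      by (simp add: null_rel_def)
  qed
qed

lemma completion_map_class:
  assumes d: "pseudometric_on V d" and d': "pseudometric_on W d'"
    and f: "\<And>x. x \<in> V \<Longrightarrow> f x \<in> W"
    and lip: "\<And>x y. x \<in> V \<Longrightarrow> y \<in> V \<Longrightarrow> d' (f x) (f y) \<le> d x y"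
    and X: "X \<in> cauchy_seqs V d"
  shows "completion_map W d' f (null_rel V d `` {X}) = null_rel W d' `` {\<lambda>k. f (X k)}"
    and "completion_map W d' f (null_rel V d `` {X}) \<in> completion W d'"
proof -
  have cauchy: "(\<lambda>k. f (Y k)) \<in> cauchy_seqs W d'" if Y: "Y \<in> cauchy_seqs V d" for Y
  proof -
    have "\<exists>N. \<forall>m\<ge>N. \<forall>n\<ge>N. d' (f (Y m)) (f (Y n)) < e" if "e > 0" for e
    proof -
      obtain N where N: "\<forall>m\<ge>N. \<forall>n\<ge>N. d (Y m) (Y n) < e"
        using cauchy_seqsD[OF Y \<open>e > 0\<close>] ..
      have "d' (f (Y m)) (f (Y n)) < e" if "m \<ge> N" "n \<ge> N" for m n
        using lip[OF cauchy_seqs_in[OF Y, of m] cauchy_seqs_in[OF Y, of n]] N that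
        by (simp add: le_less_trans)
      then show ?thesis by blast
    qed
    then show ?thesis
      using f cauchy_seqs_in[OF Y] by (auto simp: cauchy_seqs_def)
  qed
  have eq: "null_rel W d' `` {\<lambda>k. f (Y k)} = null_rel W d' `` {\<lambda>k. f (X k)}"
    if Y: "(X, Y) \<in> null_rel V d" for Y
  proof -
    have YV: "Y \<in> cauchy_seqs V d" and lim: "(\<lambda>n. d (X n) (Y n)) \<longlonglongrightarrow> 0"
      using Y by (auto simp: null_rel_def)
    have "0 \<le> d' (f (X n)) (f (Y n))" "d' (f (X n)) (f (Y n)) \<le> d (X n) (Y n)" for n
      using d' f lip cauchy_seqs_in[OF X, of n] cauchy_seqs_in[OF YV, of n]
      by (simp_all add: pseudometric_on_def)
    then have "(\<lambda>n. d' (f (X n)) (f (Y n))) \<longlonglongrightarrow> 0"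
      by (intro tendsto_sandwich[OF _ _ tendsto_const lim]) simp_all
    then have "((\<lambda>k. f (X k)), (\<lambda>k. f (Y k))) \<in> null_rel W d'"
      using cauchy X YV by (simp add: null_rel_def)
    then show ?thesis
      by (rule equiv_class_eq[OF equiv_null_rel[OF d'], symmetric])
  qed
  have self: "X \<in> null_rel V d `` {X}"
    using equiv_class_self[OF equiv_null_rel[OF d] X] .
  show 1: "completion_map W d' f (null_rel V d `` {X}) = null_rel W d' `` {\<lambda>k. f (X k)}"
    unfolding completion_map_def
  proof (rule UN_constant_eq)
    show "X \<in> null_rel V d `` {X}" by (fact self)
    show "\<forall>Y\<in>null_rel V d `` {X}.
        null_rel W d' `` {\<lambda>k. f (Y k)} = null_rel W d' `` {\<lambda>k. f (X k)}"
      using eq by blast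
  qed
  show "completion_map W d' f (null_rel V d `` {X}) \<in> completion W d'"
    unfolding 1 completion_def using cauchy[OF X] by (rule quotientI)
qed

lemma completion_functional_class:
  assumes d: "pseudometric_on V d"
    and lip: "\<And>x y. x \<in> V \<Longrightarrow> y \<in> V \<Longrightarrow> \<bar>f x - f y\<bar> \<le> d x y"
    and X: "X \<in> cauchy_seqs V d"
  shows "(\<lambda>k. f (X k)) \<longlonglongrightarrow> completion_functional f (null_rel V d `` {X})"
proof -
  have "Cauchy (\<lambda>k. f (X k))"
  proof (rule CauchyI)
    fix e :: real assume "e > 0"
    obtain N where N: "\<forall>m\<ge>N. \<forall>n\<ge>N. d (X m) (X n) < e"
      using cauchy_seqsD[OF X \<open>e > 0\<close>] ..
    have "norm (f (X m) - f (X n)) < e" if "m \<ge> N" "n \<ge> N" for m n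
      using lip[OF cauchy_seqs_in[OF X, of m] cauchy_seqs_in[OF X, of n]] N that
      unfolding real_norm_def by (meson le_less_trans)
    then show "\<exists>N. \<forall>m\<ge>N. \<forall>n\<ge>N. norm (f (X m) - f (X n)) < e"
      by blast
  qed
  then obtain l where l: "(\<lambda>k. f (X k)) \<longlonglongrightarrow> l"
    using Cauchy_convergent convergent_def by blast
  have lY: "(\<lambda>k. f (Y k)) \<longlonglongrightarrow> l" if Y: "(X, Y) \<in> null_rel V d" for Y
  proof -
    have YV: "Y \<in> cauchy_seqs V d" and lim: "(\<lambda>n. d (X n) (Y n)) \<longlonglongrightarrow> 0"
      using Y by (auto simp: null_rel_def)
    have "\<bar>f (X n) - f (Y n)\<bar> \<le> d (X n) (Y n)" for n
      using lip cauchy_seqs_in[OF X] cauchy_seqs_in[OF YV] by blast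
    then have "(\<lambda>n. f (X n) - f (Y n)) \<longlonglongrightarrow> 0"
      by (intro Lim_null_comparison[OF _ lim]) auto
    from tendsto_diff[OF l this] show ?thesis by simp
  qed
  have self: "X \<in> null_rel V d `` {X}"
    using equiv_class_self[OF equiv_null_rel[OF d] X] .
  have "completion_functional f (null_rel V d `` {X}) = l"
    unfolding completion_functional_def
  proof (rule the_equality)
    show "\<forall>Y\<in>null_rel V d `` {X}. (\<lambda>k. f (Y k)) \<longlonglongrightarrow> l"
      using lY by blast
    show "l' = l" if "\<forall>Y\<in>null_rel V d `` {X}. (\<lambda>k. f (Y k)) \<longlonglongrightarrow> l'" for l'
      using that self l LIMSEQ_unique by blast
  qed
  with l show ?thesis by simp
qed


section \<open>Test functions on Euclidean space\<close>

text \<open>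
  \<open>\<real>\<^sup>n\<close> is the library space \<^const>\<open>Euclidean_space\<close> \<open>n\<close>, whose points are the
  functions \<open>nat \<Rightarrow> real\<close> vanishing at all indices \<open>i \<ge> n\<close>.
\<close>

definition tup :: "nat \<Rightarrow> (nat \<Rightarrow> real) \<Rightarrow> nat \<Rightarrow> real" where
  "tup n x = (\<lambda>i. if i < n then x i else 0)"

definition vappend :: "nat \<Rightarrow> (nat \<Rightarrow> 'a) \<Rightarrow> (nat \<Rightarrow> 'a) \<Rightarrow> nat \<Rightarrow> 'a" where
  "vappend m x y = (\<lambda>i. if i < m then x i else y (i - m))"

definition enorm :: "nat \<Rightarrow> (nat \<Rightarrow> real) \<Rightarrow> real" where
  "enorm n x = L2_set x {..<n}"

definition C_l_Lip :: "nat \<Rightarrow> ((nat \<Rightarrow> real) \<Rightarrow> real) set" where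
  "C_l_Lip n = {\<phi>. continuous_map (Euclidean_space n) euclideanreal \<phi> \<and>
    (\<exists>(C::real) (k::nat). \<forall>x\<in>topspace (Euclidean_space n). \<forall>y\<in>topspace (Euclidean_space n).
      \<bar>\<phi> x - \<phi> y\<bar> \<le> C * (1 + enorm n x ^ k + enorm n y ^ k) * enorm n (\<lambda>i. x i - y i))}"

definition bounded_Lipschitz :: "nat \<Rightarrow> ((nat \<Rightarrow> real) \<Rightarrow> real) set" where
  "bounded_Lipschitz n = {\<phi>. bounded (\<phi> ` topspace (Euclidean_space n)) \<and>
    (\<exists>C::real. \<forall>x\<in>topspace (Euclidean_space n). \<forall>y\<in>topspace (Euclidean_space n).
      \<bar>\<phi> x - \<phi> y\<bar> \<le> C * enorm n (\<lambda>i. x i - y i))}"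


section \<open>Sublinear expectations\<close>

text \<open>
  A random variable on the set \<open>\<Omega>\<close> is a total function of which only the values on \<open>\<Omega>\<close> matter;
  hence \<open>\<H>\<close> is required to be closed under equality on \<open>\<Omega>\<close>.  That \<open>E\<close> respects equality on
  \<open>\<Omega>\<close> follows from monotonicity.
\<close>

locale sublinear_expectation =
  fixes \<Omega> :: "'w set" and \<H> :: "('w \<Rightarrow> real) set" and E :: "('w \<Rightarrow> real) \<Rightarrow> real"
  assumes cong_closed: "\<lbrakk>X \<in> \<H>; \<And>\<omega>. \<omega> \<in> \<Omega> \<Longrightarrow> X \<omega> = Y \<omega>\<rbrakk> \<Longrightarrow> Y \<in> \<H>"
    and const_in: "(\<lambda>_. c) \<in> \<H>"
    and add_in: "\<lbrakk>X \<in> \<H>; Y \<in> \<H>\<rbrakk> \<Longrightarrow> (\<lambda>\<omega>. X \<omega> + Y \<omega>) \<in> \<H>"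
    and scale_in: "X \<in> \<H> \<Longrightarrow> (\<lambda>\<omega>. c * X \<omega>) \<in> \<H>"
    and mono: "\<lbrakk>X \<in> \<H>; Y \<in> \<H>; \<And>\<omega>. \<omega> \<in> \<Omega> \<Longrightarrow> X \<omega> \<le> Y \<omega>\<rbrakk> \<Longrightarrow> E X \<le> E Y"
    and const: "E (\<lambda>_. c) = c"
    and subadd: "\<lbrakk>X \<in> \<H>; Y \<in> \<H>\<rbrakk> \<Longrightarrow> E X - E Y \<le> E (\<lambda>\<omega>. X \<omega> - Y \<omega>)"
    and pos_homogeneous: "\<lbrakk>X \<in> \<H>; 0 \<le> l\<rbrakk> \<Longrightarrow> E (\<lambda>\<omega>. l * X \<omega>) = l * E X"

text \<open>
  The distribution of \<open>X = (X\<^sub>0, \<dots>, X\<^sub>n\<^sub>-\<^sub>1)\<close> only makes sense if \<open>\<phi>(X) \<in> \<H>\<close> for every test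
  function \<open>\<phi>\<close>; this is built into the notion of a random vector.
\<close>

definition random_vector :: "('w \<Rightarrow> real) set \<Rightarrow> nat \<Rightarrow> (nat \<Rightarrow> 'w \<Rightarrow> real) \<Rightarrow> bool" where
  "random_vector \<H> n X \<longleftrightarrow> (\<forall>\<phi>\<in>C_l_Lip n. (\<lambda>\<omega>. \<phi> (tup n (\<lambda>i. X i \<omega>))) \<in> \<H>)"

definition identically_distributed ::
  "nat \<Rightarrow> ('w1 \<Rightarrow> real) set \<Rightarrow> (('w1 \<Rightarrow> real) \<Rightarrow> real) \<Rightarrow> (nat \<Rightarrow> 'w1 \<Rightarrow> real) \<Rightarrow>
    ('w2 \<Rightarrow> real) set \<Rightarrow> (('w2 \<Rightarrow> real) \<Rightarrow> real) \<Rightarrow> (nat \<Rightarrow> 'w2 \<Rightarrow> real) \<Rightarrow> bool" where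
  "identically_distributed n \<H>1 E1 X1 \<H>2 E2 X2 \<longleftrightarrow>
    random_vector \<H>1 n X1 \<and> random_vector \<H>2 n X2 \<and>
    (\<forall>\<phi>\<in>C_l_Lip n.
      E1 (\<lambda>\<omega>. \<phi> (tup n (\<lambda>i. X1 i \<omega>))) = E2 (\<lambda>\<omega>. \<phi> (tup n (\<lambda>i. X2 i \<omega>))))"

text \<open>The \<open>n\<close>-dimensional \<open>Y\<close> is independent to the \<open>m\<close>-dimensional \<open>X\<close> (an asymmetric relation).\<close>

definition independent_to ::
  "('w \<Rightarrow> real) set \<Rightarrow> (('w \<Rightarrow> real) \<Rightarrow> real) \<Rightarrow>
    nat \<Rightarrow> (nat \<Rightarrow> 'w \<Rightarrow> real) \<Rightarrow> nat \<Rightarrow> (nat \<Rightarrow> 'w \<Rightarrow> real) \<Rightarrow> bool" where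
  "independent_to \<H> E n Y m X \<longleftrightarrow>
    random_vector \<H> (m + n) (vappend m X Y) \<and>
    (\<forall>\<phi>\<in>C_l_Lip (m + n).
      E (\<lambda>\<omega>. \<phi> (tup (m + n) (vappend m (\<lambda>i. X i \<omega>) (\<lambda>i. Y i \<omega>)))) =
      E (\<lambda>\<omega>. E (\<lambda>\<omega>'. \<phi> (tup (m + n) (vappend m (\<lambda>i. X i \<omega>) (\<lambda>i. Y i \<omega>'))))))"

definition G_normal :: "('w \<Rightarrow> real) set \<Rightarrow> (('w \<Rightarrow> real) \<Rightarrow> real) \<Rightarrow> ('w \<Rightarrow> real) \<Rightarrow> bool" where
  "G_normal \<H> E X \<longleftrightarrow>
    (\<exists>X'. identically_distributed 1 \<H> E (\<lambda>_. X') \<H> E (\<lambda>_. X) \<and>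
      independent_to \<H> E 1 (\<lambda>_. X') 1 (\<lambda>_. X) \<and>
      (\<forall>a b. identically_distributed 1
        \<H> E (\<lambda>_ \<omega>. a * X \<omega> + b * X' \<omega>) \<H> E (\<lambda>_ \<omega>. sqrt (a\<^sup>2 + b\<^sup>2) * X \<omega>)))"


section \<open>The G-expectation\<close>

type_synonym path = "real \<Rightarrow> real"

text \<open>Paths are extensional, so that \<open>\<Omega>\<^sub>T\<close> is in bijection with \<open>C\<^sub>0([0,T];\<real>)\<close>.\<close>

definition path_space :: "real \<Rightarrow> path set" where
  "path_space T = {\<omega> \<in> extensional {0..T}. continuous_on {0..T} \<omega> \<and> \<omega> 0 = 0}"

definition B :: "real \<Rightarrow> path \<Rightarrow> real" where
  "B t \<omega> = \<omega> t"

definition H0 :: "real \<Rightarrow> (path \<Rightarrow> real) set" where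
  "H0 T = {X. \<exists>n\<ge>1. \<exists>t \<phi>. (\<forall>i<n. t i \<in> {0..T}) \<and> \<phi> \<in> C_l_Lip n \<and>
    (\<forall>\<omega>\<in>path_space T. X \<omega> = \<phi> (tup n (\<lambda>i. B (t i) \<omega>)))}"

text \<open>
  \<open>E\<close> is the G-expectation on \<^term>\<open>H0 T\<close>, as given by a sequence \<open>\<xi>\<^sub>0, \<xi>\<^sub>1, \<dots>\<close> of G-normal random
  variables on the sublinear expectation space \<open>(\<Omega>', \<H>', E')\<close>.
\<close>

locale G_expectation =
  path: sublinear_expectation "path_space T" "H0 T" E +
  aux: sublinear_expectation \<Omega>' \<H>' E'
  for T :: real and E :: "(path \<Rightarrow> real) \<Rightarrow> real"
    and \<Omega>' :: "'w set" and \<H>' :: "('w \<Rightarrow> real) set" and E' :: "('w \<Rightarrow> real) \<Rightarrow> real" +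
  fixes \<xi> :: "nat \<Rightarrow> 'w \<Rightarrow> real" and \<sigma>_low \<sigma>_up :: real
  assumes G_normal_xi: "G_normal \<H>' E' (\<xi> i)"
    and ident_xi: "identically_distributed 1 \<H>' E' (\<lambda>_. \<xi> i) \<H>' E' (\<lambda>_. \<xi> j)"
    and indep_xi: "i \<ge> 1 \<Longrightarrow> independent_to \<H>' E' 1 (\<lambda>_. \<xi> i) i \<xi>"
    and variance_up: "E' (\<lambda>w. (\<xi> 0 w)\<^sup>2) = \<sigma>_up\<^sup>2"
    and variance_low: "- E' (\<lambda>w. - (\<xi> 0 w)\<^sup>2) = \<sigma>_low\<^sup>2"
    and increments:
      "\<lbrakk>m \<ge> 1; t 0 = 0; \<forall>i<m. t i < t (Suc i); t m \<le> T; \<phi> \<in> C_l_Lip m\<rbrakk> \<Longrightarrow>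
        E (\<lambda>\<omega>. \<phi> (tup m (\<lambda>i. B (t (Suc i)) \<omega> - B (t i) \<omega>))) =
        E' (\<lambda>w. \<phi> (tup m (\<lambda>i. sqrt (t (Suc i) - t i) * \<xi> i w)))"


section \<open>Completed spaces of random variables and processes\<close>

definition dist_L1 :: "((path \<Rightarrow> real) \<Rightarrow> real) \<Rightarrow> (path \<Rightarrow> real) \<Rightarrow> (path \<Rightarrow> real) \<Rightarrow> real" where
  "dist_L1 E X Y = E (\<lambda>\<omega>. \<bar>X \<omega> - Y \<omega>\<bar>)"

definition L1_G :: "real \<Rightarrow> ((path \<Rightarrow> real) \<Rightarrow> real) \<Rightarrow> (nat \<Rightarrow> path \<Rightarrow> real) set set" where
  "L1_G T E = completion (H0 T) (dist_L1 E)"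

definition E_L1 :: "((path \<Rightarrow> real) \<Rightarrow> real) \<Rightarrow> (nat \<Rightarrow> path \<Rightarrow> real) set \<Rightarrow> real" where
  "E_L1 E = completion_functional E"

text \<open>\<open>Lip T t\<close> is \<open>L\<^sub>i\<^sub>p(\<Omega>\<^sub>t)\<close>, regarded as a set of random variables on \<open>\<Omega>\<^sub>T\<close> (for \<open>t \<le> T\<close>).\<close>

definition Lip :: "real \<Rightarrow> real \<Rightarrow> (path \<Rightarrow> real) set" where
  "Lip T t = {X. \<exists>n\<ge>1. \<exists>s \<phi>. (\<forall>i<n. s i \<in> {0..t}) \<and> \<phi> \<in> bounded_Lipschitz n \<and>
    (\<forall>\<omega>\<in>path_space T. X \<omega> = \<phi> (tup n (\<lambda>i. B (s i) \<omega>)))}"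

definition M0_G :: "real \<Rightarrow> (real \<Rightarrow> path \<Rightarrow> real) set" where
  "M0_G T = {\<eta>. \<exists>N\<ge>1. \<exists>t \<zeta>. t 0 = 0 \<and> t N = T \<and> (\<forall>j<N. t j < t (Suc j)) \<and>
    (\<forall>j<N. \<zeta> j \<in> Lip T (t j)) \<and>
    (\<forall>s\<in>{0..T}. \<forall>\<omega>\<in>path_space T.
      \<eta> s \<omega> = (\<Sum>j<N. \<zeta> j \<omega> * indicator {t j<..t (Suc j)} s))}"

definition dist_M1 ::
  "real \<Rightarrow> ((path \<Rightarrow> real) \<Rightarrow> real) \<Rightarrow> (real \<Rightarrow> path \<Rightarrow> real) \<Rightarrow> (real \<Rightarrow> path \<Rightarrow> real) \<Rightarrow> real" where
  "dist_M1 T E \<eta> \<theta> = E (\<lambda>\<omega>. integral {0..T} (\<lambda>s. \<bar>\<eta> s \<omega> - \<theta> s \<omega>\<bar>))"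

definition M1_G ::
  "real \<Rightarrow> ((path \<Rightarrow> real) \<Rightarrow> real) \<Rightarrow> (nat \<Rightarrow> real \<Rightarrow> path \<Rightarrow> real) set set" where
  "M1_G T E = completion (M0_G T) (dist_M1 T E)"

text \<open>\<open>\<integral>\<^sub>0\<^sup>T \<eta>\<^sub>s ds \<in> L\<^sup>1\<^sub>G\<close>, the continuous extension of the pathwise integral of simple processes.\<close>

definition integral_M1 ::
  "real \<Rightarrow> ((path \<Rightarrow> real) \<Rightarrow> real) \<Rightarrow> (nat \<Rightarrow> real \<Rightarrow> path \<Rightarrow> real) set \<Rightarrow>
    (nat \<Rightarrow> path \<Rightarrow> real) set" where
  "integral_M1 T E =
    completion_map (H0 T) (dist_L1 E) (\<lambda>\<eta> \<omega>. integral {0..T} (\<lambda>s. \<eta> s \<omega>))"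

definition \<delta> :: "real \<Rightarrow> nat \<Rightarrow> real \<Rightarrow> real" where
  "\<delta> T n s = (\<Sum>i<n. (-1) ^ i * indicator {real i * T / real n<..real (i + 1) * T / real n} s)"

text \<open>
  The product \<open>h \<eta>\<close> of \<open>\<eta> \<in> M\<^sup>1\<^sub>G\<close> with a deterministic step function \<open>h\<close>, \<open>\<bar>h\<bar> \<le> 1\<close>: the continuous
  extension of the pointwise product, which maps \<^const>\<open>M0_G\<close> into itself.
\<close>

definition mult_M1 ::
  "real \<Rightarrow> ((path \<Rightarrow> real) \<Rightarrow> real) \<Rightarrow> (real \<Rightarrow> real) \<Rightarrow>
    (nat \<Rightarrow> real \<Rightarrow> path \<Rightarrow> real) set \<Rightarrow> (nat \<Rightarrow> real \<Rightarrow> path \<Rightarrow> real) set" where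
  "mult_M1 T E h = completion_map (M0_G T) (dist_M1 T E) (\<lambda>\<eta> s \<omega>. h s * \<eta> s \<omega>)"

end

theory Submission
  imports Defs
begin

text \<open>
  The functions \<open>\<delta>\<^sub>n\<close> oscillate so fast that their integral over any subinterval of \<open>[0, T]\<close>
  is at most \<open>T / n\<close> in absolute value.  Indeed \<open>\<integral>\<^sub>0\<^sup>x \<delta>\<^sub>n\<close> is an alternating sum whose \<open>i\<close>-th term is,
  up to sign, the length of \<open>[0, x] \<inter> [iT/n, (i+1)T/n]\<close>; these lengths decrease in \<open>i\<close>, so the sum lies between \<open>0\<close> and
  its first term, hence in \<open>[0, T/n]\<close>, and the integral over \<open>[a, b]\<close> is a difference of two such
  values (\<open>alternating_overlap_le\<close>).

  If \<open>\<eta>\<close> is a simple process with coefficients \<open>\<zeta>\<^sub>0, \<dots>, \<zeta>\<^sub>N\<^sub>-\<^sub>1\<close>, it follows that along every path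
  \<open>\<bar>\<integral> \<delta>\<^sub>n \<eta>\<bar> \<le> (T/n) \<Sum>\<^sub>j \<bar>\<zeta>\<^sub>j\<bar>\<close>.  The random variable on the right is fixed up to the factor \<open>1/n\<close>,
  so the claim holds for \<open>\<eta>\<close>, at rate \<open>1/n\<close> (\<open>abs_E_integral_\<delta>_le\<close>).

  The general case is a density argument.  Multiplication by \<open>\<delta>\<^sub>n\<close>, integration over \<open>[0, T]\<close> and
  \<open>E\<close> itself are 1-Lipschitz for the respective seminorms (\<open>mult_Lipschitz\<close>, \<open>integral_Lipschitz\<close>,
  \<open>abs_E_diff_le\<close>), and the constant does not depend on \<open>n\<close>.  Replacing \<open>\<eta>\<close> by a simple process at
  distance less than \<open>e/2\<close> therefore changes the expectation by at most \<open>e/2\<close>, uniformly in \<open>n\<close>.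

  Two closure properties make these statements meaningful: \<open>\<delta>\<^sub>n \<eta>\<close> is again a simple process, on a
  common refinement of the two partitions (\<open>M0_G_step_mult\<close>), and the integrals of \<open>\<eta>\<close> and
  \<open>\<bar>\<eta> - \<theta>\<bar>\<close> are finite sums of elements of \<^term>\<open>H0 T\<close> (\<open>integral_pair_in_H0\<close>).
\<close>

section \<open>Step functions on a partition\<close>

definition step_fun :: "nat \<Rightarrow> (nat \<Rightarrow> real) \<Rightarrow> (nat \<Rightarrow> real) \<Rightarrow> real \<Rightarrow> real" where
  "step_fun N t c s = (\<Sum>j<N. c j * indicator {t j<..t (Suc j)} s)"

definition time_partition :: "real \<Rightarrow> nat \<Rightarrow> (nat \<Rightarrow> real) \<Rightarrow> bool" where
  "time_partition T N t \<longleftrightarrow> t 0 = 0 \<and> t N = T \<and> (\<forall>j<N. t j < t (Suc j))"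

lemma partition_mono:
  assumes "time_partition T N t" "i \<le> j" "j \<le> N"
  shows "t i \<le> t j"
  using assms(2,3)
proof (induction j rule: dec_induct)
  case (step n)
  then have "t n < t (Suc n)"
    using assms(1) by (simp add: time_partition_def)
  with step show ?case by simp
qed simp

lemma partition_bounds:
  assumes "time_partition T N t" "j \<le> N"
  shows "0 \<le> t j" "t j \<le> T"
  using partition_mono[OF assms(1), of 0 j] partition_mono[OF assms(1), of j N] assms
  by (auto simp: time_partition_def)

lemma partition_cell:
  assumes "time_partition T N t" "0 < s" "s \<le> T"
  obtains j where "j < N" "s \<in> {t j<..t (Suc j)}"
proof -
  have "s \<le> t M \<Longrightarrow> \<exists>j<M. s \<in> {t j<..t (Suc j)}" for M
  proof (induction M)
    case 0
    then show ?case using assms by (simp add: time_partition_def)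
  next
    case (Suc M)
    then show ?case
      by (cases "s \<le> t M") (auto intro: less_SucI)
  qed
  from this[of N] show ?thesis
    using assms that by (auto simp: time_partition_def)
qed

lemma step_fun_cell:
  assumes t: "time_partition T N t" and j: "j < N" and s: "s \<in> {t j<..t (Suc j)}"
  shows "step_fun N t c s = c j"
proof -
  have "s \<notin> {t i<..t (Suc i)}" if "i < N" "i \<noteq> j" for i
    using partition_mono[OF t, of "Suc i" j] partition_mono[OF t, of "Suc j" i] that j s
    by (cases i j rule: linorder_cases) auto
  then have "step_fun N t c s = (\<Sum>i<N. if i = j then c j else 0)"
    unfolding step_fun_def using s by (intro sum.cong) auto
  then show ?thesis
    using j by simp
qed

lemma step_fun_zero:
  assumes "time_partition T N t"
  shows "step_fun N t c 0 = 0"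
proof -
  have "0 \<notin> {t j<..t (Suc j)}" if "j < N" for j
    using partition_bounds(1)[OF assms, of j] that by simp
  then show ?thesis
    unfolding step_fun_def by simp
qed

lemma abs_step_fun_le:
  assumes t: "time_partition T N t" and c: "\<And>j. j < N \<Longrightarrow> \<bar>c j\<bar> \<le> K" and "0 \<le> K" and s: "s \<in> {0..T}"
  shows "\<bar>step_fun N t c s\<bar> \<le> K"
proof (cases "s = 0")
  case True
  then show ?thesis using step_fun_zero[OF t] \<open>0 \<le> K\<close> by simp
next
  case False
  with s obtain j where j: "j < N" "s \<in> {t j<..t (Suc j)}"
    using partition_cell[OF t, of s] by auto
  show ?thesis
    using c[OF j(1)] by (simp only: step_fun_cell[OF t j])
qed

text \<open>
  A pointwise combination of two step functions has one value on each intersection of cells.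
  Nesting the two step functions expresses this without a common refinement; \<open>g 0 0 = 0\<close> takes
  care of the time \<open>0\<close>, which lies in no cell.
\<close>

lemma combine_step_funs:
  assumes t: "time_partition T N t" and u: "time_partition T M u" and "g 0 0 = 0" and s: "s \<in> {0..T}"
  shows "g (step_fun N t c s) (step_fun M u d s) =
    step_fun N t (\<lambda>j. step_fun M u (\<lambda>k. g (c j) (d k)) s) s"
proof (cases "s = 0")
  case True
  then show ?thesis using step_fun_zero[OF t] step_fun_zero[OF u] \<open>g 0 0 = 0\<close> by simp
next
  case False
  with s have "0 < s" "s \<le> T" by auto
  obtain j where j: "j < N" "s \<in> {t j<..t (Suc j)}"
    using partition_cell[OF t \<open>0 < s\<close> \<open>s \<le> T\<close>] .
  obtain k where k: "k < M" "s \<in> {u k<..u (Suc k)}"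
    using partition_cell[OF u \<open>0 < s\<close> \<open>s \<le> T\<close>] .
  show ?thesis
    by (simp only: step_fun_cell[OF t j] step_fun_cell[OF u k])
qed

text \<open>The length of \<open>]a, b] \<inter> ]l, r]\<close>.\<close>

definition overlap :: "real \<Rightarrow> real \<Rightarrow> real \<Rightarrow> real \<Rightarrow> real" where
  "overlap a b l r = max 0 (min b r - max a l)"

lemma has_integral_overlap:
  fixes a b l r T :: real
  assumes "0 \<le> a" "b \<le> T"
  shows "((\<lambda>s. indicator {a<..b} s * indicator {l<..r} s) has_integral overlap a b l r) {0..T}"
proof -
  let ?S = "{max a l<..min b r}"
  have "((\<lambda>_. 1::real) has_integral measure lborel ?S) ?S"
    by (intro has_integral_measure_lborel emeasure_bounded_finite
        bounded_subset[OF bounded_closed_interval[of "max a l" "min b r"]]) auto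
  moreover have "measure lborel ?S = overlap a b l r"
    by (cases "max a l \<le> min b r") (auto simp: overlap_def)
  ultimately have "((\<lambda>s. if s \<in> ?S then 1 else 0) has_integral overlap a b l r) {0..T}"
    using assms by (subst has_integral_restrict) auto
  moreover have "(\<lambda>s. if s \<in> ?S then 1 else 0) =
      (\<lambda>s. indicator {a<..b} s * indicator {l<..r} s :: real)"
    by (auto simp: indicator_def)
  ultimately show ?thesis by simp
qed

lemma has_integral_double_step_fun:
  assumes t: "time_partition T N t"
  shows "((\<lambda>s. step_fun N t (\<lambda>j. step_fun M u (\<lambda>k. g j k) s) s) has_integral
    (\<Sum>j<N. \<Sum>k<M. g j k * overlap (t j) (t (Suc j)) (u k) (u (Suc k)))) {0..T}"
proof -
  have "((\<lambda>s. \<Sum>j<N. \<Sum>k<M. g j k *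
      (indicator {t j<..t (Suc j)} s * indicator {u k<..u (Suc k)} s)) has_integral
    (\<Sum>j<N. \<Sum>k<M. g j k * overlap (t j) (t (Suc j)) (u k) (u (Suc k)))) {0..T}"
    using partition_bounds[OF t]
    by (intro has_integral_sum has_integral_mult_right has_integral_overlap) auto
  moreover have "step_fun N t (\<lambda>j. step_fun M u (\<lambda>k. g j k) s) s = (\<Sum>j<N. \<Sum>k<M. g j k *
      (indicator {t j<..t (Suc j)} s * indicator {u k<..u (Suc k)} s))" for s
    unfolding step_fun_def sum_distrib_right by (simp add: mult_ac)
  ultimately show ?thesis by simp
qed

lemma has_integral_combined_step_funs:
  assumes "time_partition T N t" "time_partition T M u" "g 0 0 = 0"
  shows "((\<lambda>s. g (step_fun N t c s) (step_fun M u d s)) has_integral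
    (\<Sum>j<N. \<Sum>k<M. g (c j) (d k) * overlap (t j) (t (Suc j)) (u k) (u (Suc k)))) {0..T}"
proof (rule has_integral_eq)
  show "((\<lambda>s. step_fun N t (\<lambda>j. step_fun M u (\<lambda>k. g (c j) (d k)) s) s) has_integral
    (\<Sum>j<N. \<Sum>k<M. g (c j) (d k) * overlap (t j) (t (Suc j)) (u k) (u (Suc k)))) {0..T}"
    by (rule has_integral_double_step_fun[OF assms(1)])
  show "step_fun N t (\<lambda>j. step_fun M u (\<lambda>k. g (c j) (d k)) s) s =
      g (step_fun N t c s) (step_fun M u d s)" if "s \<in> {0..T}" for s
    by (rule combine_step_funs[of T N t M u g s c d, OF assms that, symmetric])
qed


section \<open>The oscillating function\<close>

text \<open>
  For \<open>n > 0\<close>, splitting off the first term leaves the negative of an alternating sum for the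
  shifted sequence, which lies in \<open>[0, g 1]\<close> by induction; so the whole sum lies in \<open>[g 0 - g 1, g 0]\<close>.
\<close>

lemma alternating_sum_bounds:
  fixes g :: "nat \<Rightarrow> real"
  assumes "\<And>i. 0 \<le> g i" "\<And>i. g (Suc i) \<le> g i"
  shows "0 \<le> (\<Sum>i<n. (-1) ^ i * g i)" "(\<Sum>i<n. (-1) ^ i * g i) \<le> g 0"
proof -
  have "0 \<le> (\<Sum>i<n. (-1) ^ i * g i) \<and> (\<Sum>i<n. (-1) ^ i * g i) \<le> g 0"
    using assms
  proof (induction n arbitrary: g)
    case (Suc n)
    have "(\<Sum>i<Suc n. (-1) ^ i * g i) = g 0 - (\<Sum>i<n. (-1) ^ i * g (Suc i))"
      by (simp add: sum.lessThan_Suc_shift sum_negf del: sum.lessThan_Suc)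
    with Suc.IH[of "\<lambda>i. g (Suc i)"] Suc.prems show ?case
      by (smt (verit))
  qed simp
  then show "0 \<le> (\<Sum>i<n. (-1) ^ i * g i)" "(\<Sum>i<n. (-1) ^ i * g i) \<le> g 0"
    by auto
qed

lemma partition_uniform:
  assumes "0 < T" "0 < n"
  shows "time_partition T n (\<lambda>i. real i * T / real n)"
  using assms by (auto simp: time_partition_def divide_strict_right_mono)

lemma \<delta>_eq_step_fun: "\<delta> T n = step_fun n (\<lambda>i. real i * T / real n) (\<lambda>i. (-1) ^ i)"
  by (simp add: \<delta>_def step_fun_def fun_eq_iff)

text \<open>
  The sum is the integral of \<open>\<delta>\<^sub>n\<close> over \<open>]a, b]\<close>.  The overlap lengths with \<open>]a, b]\<close> are not monotone
  in \<open>i\<close>, but those with \<open>]0, b]\<close> and \<open>]0, a]\<close> are, and both alternating sums lie in \<open>[0, T/n]\<close>.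
\<close>

lemma alternating_overlap_le:
  assumes "0 < T" "a \<le> b" "0 \<le> a"
  shows "\<bar>\<Sum>i<n. (-1) ^ i *
    overlap a b (real i * T / real n) (real (Suc i) * T / real n)\<bar> \<le> T / real n"
proof -
  define h where "h = T / real n"
  have h: "0 \<le> h" using assms by (simp add: h_def)
  \<comment> \<open>The length of the part of the \<open>i\<close>-th interval that lies to the left of \<open>x\<close>.\<close>
  define G where "G x i = max 0 (min h (x - real i * h))" for x i
  have G: "0 \<le> (\<Sum>i<n. (-1) ^ i * G x i)" "(\<Sum>i<n. (-1) ^ i * G x i) \<le> h" for x
  proof -
    have "G x 0 \<le> h"
      using h by (simp add: G_def)
    moreover have "0 \<le> G x i" "G x (Suc i) \<le> G x i" for i
      using h by (auto simp: G_def algebra_simps)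
    ultimately show "0 \<le> (\<Sum>i<n. (-1) ^ i * G x i)" "(\<Sum>i<n. (-1) ^ i * G x i) \<le> h"
      using alternating_sum_bounds[of "G x" n] by auto
  qed
  have "overlap a b (real i * T / real n) (real (Suc i) * T / real n) = G b i - G a i" for i
  proof -
    have "real i * T / real n = real i * h" "real (Suc i) * T / real n = real i * h + h"
      by (simp_all add: h_def add_divide_distrib distrib_right)
    then show ?thesis
      using assms h unfolding overlap_def G_def min_def max_def by (smt (verit))
  qed
  then have "(\<Sum>i<n. (-1) ^ i * overlap a b (real i * T / real n) (real (Suc i) * T / real n)) =
    (\<Sum>i<n. (-1) ^ i * G b i) - (\<Sum>i<n. (-1) ^ i * G a i)"
    by (simp add: right_diff_distrib sum_subtractf)
  with G[of a] G[of b] show ?thesis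
    by (simp add: h_def)
qed

lemma abs_integral_\<delta>_step_fun_le:
  assumes T: "0 < T" and n: "0 < n" and t: "time_partition T N t"
  shows "\<bar>integral {0..T} (\<lambda>s. \<delta> T n s * step_fun N t c s)\<bar> \<le> (T / real n) * (\<Sum>j<N. \<bar>c j\<bar>)"
proof -
  let ?u = "\<lambda>i. real i * T / real n"
  define w where "w j i = overlap (t j) (t (Suc j)) (?u i) (?u (Suc i))" for j i
  let ?I = "\<lambda>j. \<Sum>i<n. (-1) ^ i * w j i"
  have "integral {0..T} (\<lambda>s. \<delta> T n s * step_fun N t c s) =
      (\<Sum>j<N. \<Sum>i<n. (-1) ^ i * c j * w j i)"
    unfolding \<delta>_eq_step_fun w_def
    by (rule integral_unique, rule has_integral_combined_step_funs
        [OF t partition_uniform[OF T n], where g = "\<lambda>x y. y * x" and c = c and d = "\<lambda>i. (-1) ^ i"]) simp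
  also have "\<dots> = (\<Sum>j<N. c j * ?I j)"
    by (simp add: sum_distrib_left mult.assoc mult.left_commute)
  also have "\<bar>\<dots>\<bar> \<le> (\<Sum>j<N. \<bar>c j * ?I j\<bar>)"
    by (rule sum_abs)
  also have "\<dots> \<le> (\<Sum>j<N. \<bar>c j\<bar> * (T / real n))"
  proof (rule sum_mono)
    fix j assume "j \<in> {..<N}"
    then have "\<bar>?I j\<bar> \<le> T / real n"
      unfolding w_def using partition_mono[OF t, of j "Suc j"] partition_bounds[OF t, of j] T
      by (intro alternating_overlap_le) simp_all
    then show "\<bar>c j * ?I j\<bar> \<le> \<bar>c j\<bar> * (T / real n)"
      unfolding abs_mult by (intro mult_left_mono) auto
  qed
  also have "\<dots> = (T / real n) * (\<Sum>j<N. \<bar>c j\<bar>)"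
    by (simp add: sum_distrib_left mult.commute)
  finally show ?thesis .
qed


section \<open>Random variables and simple processes\<close>

text \<open>
  The topology of \<^term>\<open>Euclidean_space n\<close> is that of coordinatewise convergence, in which
  \<^term>\<open>enorm n\<close> is continuous since it involves only finitely many coordinates; a Lipschitz
  function is therefore continuous.
\<close>

lemma bounded_Lipschitz_imp_C_l_Lip:
  assumes "\<phi> \<in> bounded_Lipschitz n"
  shows "\<phi> \<in> C_l_Lip n"
proof -
  let ?S = "topspace (Euclidean_space n)"
  obtain C where C: "\<bar>\<phi> x - \<phi> y\<bar> \<le> C * enorm n (\<lambda>i. x i - y i)" if "x \<in> ?S" "y \<in> ?S" for x y
    using assms by (auto simp: bounded_Lipschitz_def)
  have "continuous_on ?S \<phi>"
    unfolding continuous_on_def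
  proof
    fix x assume x: "x \<in> ?S"
    have "continuous_on UNIV (\<lambda>y::nat \<Rightarrow> real. C * enorm n (\<lambda>i. y i - x i))"
      unfolding enorm_def L2_set_def
      by (intro continuous_intros continuous_on_product_coordinates)
    then have "((\<lambda>y. C * enorm n (\<lambda>i. y i - x i)) \<longlongrightarrow> C * enorm n (\<lambda>i. x i - x i)) (at x within ?S)"
      by (meson UNIV_I continuous_on_def subset_UNIV tendsto_within_subset)
    then have "((\<lambda>y. C * enorm n (\<lambda>i. y i - x i)) \<longlongrightarrow> 0) (at x within ?S)"
      by (simp add: enorm_def L2_set_def)
    then have "((\<lambda>y. \<phi> y - \<phi> x) \<longlongrightarrow> 0) (at x within ?S)"
      by (rule Lim_null_comparison[rotated]) (auto simp: eventually_at_filter C x)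
    then show "(\<phi> \<longlongrightarrow> \<phi> x) (at x within ?S)"
      by (simp add: LIM_zero_iff)
  qed
  then have "continuous_map (Euclidean_space n) euclideanreal \<phi>"
    by (simp add: Euclidean_space_def euclidean_product_topology)
  moreover have "\<bar>\<phi> x - \<phi> y\<bar> \<le> \<bar>C\<bar> * (1 + enorm n x ^ 0 + enorm n y ^ 0) * enorm n (\<lambda>i. x i - y i)"
    if "x \<in> ?S" "y \<in> ?S" for x y
  proof -
    have "0 \<le> enorm n (\<lambda>i. x i - y i)"
      by (simp add: enorm_def)
    then have "C * enorm n (\<lambda>i. x i - y i) \<le> (\<bar>C\<bar> * 3) * enorm n (\<lambda>i. x i - y i)"
      by (intro mult_right_mono) auto
    with C[OF that] show ?thesis by simp
  qed
  ultimately show ?thesis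
    unfolding C_l_Lip_def by blast
qed

lemma Lip_imp_H0:
  assumes "X \<in> Lip T t" "t \<le> T"
  shows "X \<in> H0 T"
proof -
  obtain n s \<phi> where "n \<ge> 1" "\<forall>i<n. s i \<in> {0..t}" "\<phi> \<in> bounded_Lipschitz n"
    "\<forall>\<omega>\<in>path_space T. X \<omega> = \<phi> (tup n (\<lambda>i. B (s i) \<omega>))"
    using assms(1) unfolding Lip_def by blast
  moreover from this(2) have "\<forall>i<n. s i \<in> {0..T}"
    using assms(2) by force
  ultimately show ?thesis
    using bounded_Lipschitz_imp_C_l_Lip unfolding H0_def by blast
qed

lemma Lip_mono:
  assumes "X \<in> Lip T s" "s \<le> t"
  shows "X \<in> Lip T t"
proof -
  obtain n r \<phi> where "n \<ge> 1" "\<forall>i<n. r i \<in> {0..s}" "\<phi> \<in> bounded_Lipschitz n"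
    "\<forall>\<omega>\<in>path_space T. X \<omega> = \<phi> (tup n (\<lambda>i. B (r i) \<omega>))"
    using assms(1) unfolding Lip_def by blast
  moreover from this(2) have "\<forall>i<n. r i \<in> {0..t}"
    using assms(2) by force
  ultimately show ?thesis
    unfolding Lip_def by blast
qed

lemma Lip_scale:
  assumes "X \<in> Lip T t"
  shows "(\<lambda>\<omega>. c * X \<omega>) \<in> Lip T t"
proof -
  obtain n s \<phi> where n: "n \<ge> 1" "\<forall>i<n. s i \<in> {0..t}" and \<phi>: "\<phi> \<in> bounded_Lipschitz n"
    and X: "\<forall>\<omega>\<in>path_space T. X \<omega> = \<phi> (tup n (\<lambda>i. B (s i) \<omega>))"
    using assms unfolding Lip_def by blast
  let ?S = "topspace (Euclidean_space n)"
  obtain C where C: "\<bar>\<phi> x - \<phi> y\<bar> \<le> C * enorm n (\<lambda>i. x i - y i)" if "x \<in> ?S" "y \<in> ?S" for x y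
    using \<phi> by (auto simp: bounded_Lipschitz_def)
  have "\<bar>c * \<phi> x - c * \<phi> y\<bar> \<le> (\<bar>c\<bar> * C) * enorm n (\<lambda>i. x i - y i)" if "x \<in> ?S" "y \<in> ?S" for x y
    using mult_left_mono[OF C[OF that], of "\<bar>c\<bar>"]
    by (simp add: abs_mult[symmetric] right_diff_distrib mult.assoc)
  moreover have "bounded ((\<lambda>x. c * \<phi> x) ` ?S)"
    using bounded_scaling[of "\<phi> ` ?S" c] \<phi> by (simp add: bounded_Lipschitz_def image_image)
  ultimately have "(\<lambda>x. c * \<phi> x) \<in> bounded_Lipschitz n"
    unfolding bounded_Lipschitz_def by blast
  with n X show ?thesis
    unfolding Lip_def by (auto intro!: exI[of _ n] exI[of _ s] exI[of _ "\<lambda>x. c * \<phi> x"])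
qed

lemma H0_abs:
  assumes "X \<in> H0 T"
  shows "(\<lambda>\<omega>. \<bar>X \<omega>\<bar>) \<in> H0 T"
proof -
  obtain n s \<phi> where n: "n \<ge> 1" "\<forall>i<n. s i \<in> {0..T}" and \<phi>: "\<phi> \<in> C_l_Lip n"
    and X: "\<forall>\<omega>\<in>path_space T. X \<omega> = \<phi> (tup n (\<lambda>i. B (s i) \<omega>))"
    using assms unfolding H0_def by blast
  have "(\<lambda>x. \<bar>\<phi> x\<bar>) \<in> C_l_Lip n"
    using \<phi> unfolding C_l_Lip_def
    by (auto intro!: continuous_map_real_abs) (meson abs_triangle_ineq3 order_trans)
  with n X show ?thesis
    unfolding H0_def by (auto intro!: exI[of _ n] exI[of _ s] exI[of _ "\<lambda>x. \<bar>\<phi> x\<bar>"])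
qed

text \<open>
  Bundling the data of a simple process into one predicate allows two processes with unrelated
  partitions to be treated side by side.
\<close>

definition represents ::
  "real \<Rightarrow> nat \<Rightarrow> (nat \<Rightarrow> real) \<Rightarrow> (nat \<Rightarrow> path \<Rightarrow> real) \<Rightarrow> (real \<Rightarrow> path \<Rightarrow> real) \<Rightarrow> bool" where
  "represents T N t \<zeta> \<eta> \<longleftrightarrow> time_partition T N t \<and> (\<forall>j<N. \<zeta> j \<in> Lip T (t j)) \<and>
    (\<forall>s\<in>{0..T}. \<forall>\<omega>\<in>path_space T. \<eta> s \<omega> = step_fun N t (\<lambda>j. \<zeta> j \<omega>) s)"

lemma M0_G_iff: "\<eta> \<in> M0_G T \<longleftrightarrow> (\<exists>N\<ge>1. \<exists>t \<zeta>. represents T N t \<zeta> \<eta>)"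
  unfolding M0_G_def represents_def time_partition_def step_fun_def
  by (simp only: mem_Collect_eq conj_assoc)

lemma representsD:
  assumes "represents T N t \<zeta> \<eta>"
  shows "time_partition T N t"
    and "j < N \<Longrightarrow> \<zeta> j \<in> Lip T (t j)"
    and "s \<in> {0..T} \<Longrightarrow> \<omega> \<in> path_space T \<Longrightarrow> \<eta> s \<omega> = step_fun N t (\<lambda>j. \<zeta> j \<omega>) s"
  using assms by (auto simp: represents_def)

text \<open>
  A criterion that leaves the enumeration of the partition aside: it suffices to know a finite set
  of possible jump times and to check the process on the gaps between neighbouring elements.  This suits common refinements, which are
  unions of such sets.
\<close>

lemma M0_G_intro_finite_set:
  assumes T: "0 < T" and P: "finite P" "0 \<in> P" "T \<in> P" "P \<subseteq> {0..T}"
    and zero: "\<And>\<omega>. \<omega> \<in> path_space T \<Longrightarrow> \<eta> 0 \<omega> = 0"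
    and gap: "\<And>p q. p \<in> P \<Longrightarrow> q \<in> P \<Longrightarrow> p < q \<Longrightarrow> P \<inter> {p<..<q} = {} \<Longrightarrow>
      \<exists>Z\<in>Lip T p. \<forall>s\<in>{p<..q}. \<forall>\<omega>\<in>path_space T. \<eta> s \<omega> = Z \<omega>"
  shows "\<eta> \<in> M0_G T"
proof -
  define xs where "xs = sorted_list_of_set P"
  define N where "N = length xs - 1"
  have set: "set xs = P" and sorted: "sorted_wrt (<) xs"
    using P by (simp_all add: xs_def)
  have "xs \<noteq> []" using P set by auto
  then have len: "length xs = Suc N"
    by (simp add: N_def)
  have less: "xs ! i < xs ! j" if "i < j" "j \<le> N" for i j
    using sorted_wrt_nth_less[OF sorted, of i j] that len by simp
  have mem: "xs ! i \<in> P" if "i \<le> N" for i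
    using that len set nth_mem[of i xs] by auto
  have index: "\<exists>i\<le>N. xs ! i = p" if "p \<in> P" for p
    using that set len by (metis in_set_conv_nth less_Suc_eq_le)
  have first: "xs ! 0 = 0"
  proof -
    obtain i where "i \<le> N" "xs ! i = 0" using index[OF P(2)] by blast
    moreover have "0 \<le> xs ! 0" using mem[of 0] P(4) by auto
    ultimately show ?thesis using less[of 0 i] by (cases "i = 0") auto
  qed
  have last: "xs ! N = T"
  proof -
    obtain i where "i \<le> N" "xs ! i = T" using index[OF P(3)] by blast
    moreover have "xs ! N \<le> T" using mem[of N] P(4) by auto
    ultimately show ?thesis using less[of i N] by (cases "i = N") auto
  qed
  have t: "time_partition T N ((!) xs)"
    using first last less by (simp add: time_partition_def)
  have "N \<ge> 1"
    using first last T by (cases N) auto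
  have "\<exists>Z\<in>Lip T (xs ! j). \<forall>s\<in>{xs ! j<..xs ! Suc j}. \<forall>\<omega>\<in>path_space T. \<eta> s \<omega> = Z \<omega>"
    if "j < N" for j
  proof (rule gap)
    have "False" if "p \<in> P" "xs ! j < p" "p < xs ! Suc j" for p
    proof -
      obtain i where "i \<le> N" "xs ! i = p" using index[OF \<open>p \<in> P\<close>] by blast
      then show False
        using that less[of i j] less[of "Suc j" i] \<open>j < N\<close>
        by (cases "i = j"; cases "i = Suc j"; cases "i < j") auto
    qed
    then show "P \<inter> {xs ! j<..<xs ! Suc j} = {}" by auto
  qed (use that mem less in auto)
  then obtain \<zeta> where \<zeta>: "\<And>j. j < N \<Longrightarrow> \<zeta> j \<in> Lip T (xs ! j)"
    "\<And>j s \<omega>. j < N \<Longrightarrow> s \<in> {xs ! j<..xs ! Suc j} \<Longrightarrow> \<omega> \<in> path_space T \<Longrightarrow> \<eta> s \<omega> = \<zeta> j \<omega>"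
    by metis
  have "\<eta> s \<omega> = step_fun N ((!) xs) (\<lambda>j. \<zeta> j \<omega>) s" if "s \<in> {0..T}" "\<omega> \<in> path_space T" for s \<omega>
  proof (cases "s = 0")
    case True
    then show ?thesis using zero that step_fun_zero[OF t] by simp
  next
    case False
    with that obtain j where j: "j < N" "s \<in> {xs ! j<..xs ! Suc j}"
      using partition_cell[OF t, of s] by auto
    show ?thesis
      using \<zeta>(2)[OF j that(2)] by (simp only: step_fun_cell[OF t j])
  qed
  with t \<open>N \<ge> 1\<close> \<zeta>(1) show ?thesis
    unfolding M0_G_iff represents_def by blast
qed

lemma partition_gap:
  assumes t: "time_partition T N t" and "t ` {..N} \<subseteq> P" "P \<inter> {p<..<q} = {}" "0 \<le> p" "p < q" "q \<le> T"
  obtains j where "j < N" "t j \<le> p" "q \<le> t (Suc j)"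
proof -
  obtain j where j: "j < N" "q \<in> {t j<..t (Suc j)}"
    using partition_cell[OF t order_le_less_trans[OF assms(4,5)] assms(6)] .
  then have "t j \<in> P" using assms by auto
  with j have "t j \<le> p" using assms by fastforce
  with j that show ?thesis by auto
qed

text \<open>
  On a gap \<open>]p, q]\<close> of the common refinement the product is \<open>d\<^sub>k \<zeta>\<^sub>j\<close>, and \<open>\<zeta>\<^sub>j\<close> is known at time
  \<open>t\<^sub>j \<le> p\<close>: refining a partition keeps the coefficients adapted.
\<close>

lemma M0_G_step_mult:
  assumes T: "0 < T" and u: "time_partition T M u" and "\<eta> \<in> M0_G T"
  shows "(\<lambda>s \<omega>. step_fun M u d s * \<eta> s \<omega>) \<in> M0_G T"
proof -
  obtain N t \<zeta> where "represents T N t \<zeta> \<eta>"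
    using \<open>\<eta> \<in> M0_G T\<close> unfolding M0_G_iff by blast
  note t = representsD(1)[OF this] and \<zeta> = representsD(2)[OF this] and \<eta> = representsD(3)[OF this]
  let ?P = "t ` {..N} \<union> u ` {..M}"
  show ?thesis
  proof (rule M0_G_intro_finite_set[OF T, of ?P])
    show "finite ?P" by simp
    show "0 \<in> ?P" "T \<in> ?P"
      using t by (force simp: time_partition_def)+
    show P: "?P \<subseteq> {0..T}"
      using partition_bounds[OF t] partition_bounds[OF u] by auto
    show "step_fun M u d 0 * \<eta> 0 \<omega> = 0" for \<omega>
      using step_fun_zero[OF u] by simp
    fix p q assume pq: "p \<in> ?P" "q \<in> ?P" "p < q" "?P \<inter> {p<..<q} = {}"
    then have bounds: "0 \<le> p" "q \<le> T" using P by auto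
    obtain j where j: "j < N" "t j \<le> p" "q \<le> t (Suc j)"
      using partition_gap[OF t Un_upper1 pq(4) bounds(1) pq(3) bounds(2)] .
    obtain k where k: "k < M" "u k \<le> p" "q \<le> u (Suc k)"
      using partition_gap[OF u Un_upper2 pq(4) bounds(1) pq(3) bounds(2)] .
    have "step_fun M u d s * \<eta> s \<omega> = d k * \<zeta> j \<omega>" if "s \<in> {p<..q}" "\<omega> \<in> path_space T" for s \<omega>
    proof -
      have s: "s \<in> {0..T}" "s \<in> {t j<..t (Suc j)}" "s \<in> {u k<..u (Suc k)}"
        using that bounds j k by auto
      show ?thesis
        by (simp only: \<eta>[OF s(1) that(2)] step_fun_cell[OF t j(1) s(2)] step_fun_cell[OF u k(1) s(3)])
    qed
    moreover have "(\<lambda>\<omega>. d k * \<zeta> j \<omega>) \<in> Lip T p"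
      using Lip_mono[OF Lip_scale[OF \<zeta>[OF j(1)]] j(2)] .
    ultimately show "\<exists>Z\<in>Lip T p. \<forall>s\<in>{p<..q}. \<forall>\<omega>\<in>path_space T. step_fun M u d s * \<eta> s \<omega> = Z \<omega>"
      by (intro bexI[of _ "\<lambda>\<omega>. d k * \<zeta> j \<omega>"] ballI)
  qed
qed

lemma M0_G_pair_integrable:
  fixes g :: "real \<Rightarrow> real \<Rightarrow> real"
  assumes "\<eta> \<in> M0_G T" "\<theta> \<in> M0_G T" "\<omega> \<in> path_space T" "g 0 0 = 0"
  shows "(\<lambda>s. g (\<eta> s \<omega>) (\<theta> s \<omega>)) integrable_on {0..T}"
proof -
  obtain N t \<zeta> where "represents T N t \<zeta> \<eta>"
    using assms(1) unfolding M0_G_iff by blast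
  note t = representsD(1)[OF this] and \<zeta> = representsD(2)[OF this] and \<eta> = representsD(3)[OF this]
  obtain M u \<rho> where "represents T M u \<rho> \<theta>"
    using assms(2) unfolding M0_G_iff by blast
  note u = representsD(1)[OF this] and \<rho> = representsD(2)[OF this] and \<theta> = representsD(3)[OF this]
  have "(\<lambda>s. g (step_fun N t (\<lambda>j. \<zeta> j \<omega>) s) (step_fun M u (\<lambda>j. \<rho> j \<omega>) s)) integrable_on {0..T}"
    by (rule has_integral_integrable, rule has_integral_combined_step_funs
        [OF t u, where g = g and c = "\<lambda>j. \<zeta> j \<omega>" and d = "\<lambda>j. \<rho> j \<omega>"]) (fact assms)
  then show ?thesis
    by (rule integrable_eq) (simp only: \<eta>[OF _ assms(3)] \<theta>[OF _ assms(3)])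
qed


section \<open>Lipschitz continuity of expectation, integral and multiplication\<close>

lemma cauchy_seqs_image:
  assumes X: "X \<in> cauchy_seqs V d"
    and f: "\<And>x. x \<in> V \<Longrightarrow> f x \<in> W"
    and lip: "\<And>x y. x \<in> V \<Longrightarrow> y \<in> V \<Longrightarrow> d' (f x) (f y) \<le> d x y"
  shows "(\<lambda>k. f (X k)) \<in> cauchy_seqs W d'"
proof -
  have "\<exists>N. \<forall>m\<ge>N. \<forall>n\<ge>N. d' (f (X m)) (f (X n)) < e" if "e > 0" for e
  proof -
    obtain N where N: "\<forall>m\<ge>N. \<forall>n\<ge>N. d (X m) (X n) < e"
      using cauchy_seqsD[OF X \<open>e > 0\<close>] ..
    have "d' (f (X m)) (f (X n)) < e" if "m \<ge> N" "n \<ge> N" for m n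
      using le_less_trans[OF lip[OF cauchy_seqs_in[OF X] cauchy_seqs_in[OF X]]] N that by blast
    then show ?thesis by blast
  qed
  with f cauchy_seqs_in[OF X] show ?thesis
    by (auto simp: cauchy_seqs_def)
qed

context sublinear_expectation
begin

lemma diff_in: "X \<in> \<H> \<Longrightarrow> Y \<in> \<H> \<Longrightarrow> (\<lambda>\<omega>. X \<omega> - Y \<omega>) \<in> \<H>"
  using add_in[of X "\<lambda>\<omega>. -1 * Y \<omega>"] scale_in[of Y "-1"] by simp

lemma sum_in: "(\<And>i. i \<in> I \<Longrightarrow> X i \<in> \<H>) \<Longrightarrow> (\<lambda>\<omega>. \<Sum>i\<in>I. X i \<omega>) \<in> \<H>"
  by (induction I rule: infinite_finite_induct) (auto intro: const_in add_in)

lemma add_le: "X \<in> \<H> \<Longrightarrow> Y \<in> \<H> \<Longrightarrow> E (\<lambda>\<omega>. X \<omega> + Y \<omega>) \<le> E X + E Y"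
  using subadd[of "\<lambda>\<omega>. X \<omega> + Y \<omega>" Y] add_in[of X Y] by simp

lemma nonneg: "X \<in> \<H> \<Longrightarrow> (\<And>\<omega>. \<omega> \<in> \<Omega> \<Longrightarrow> 0 \<le> X \<omega>) \<Longrightarrow> 0 \<le> E X"
  using mono[OF const_in, of X 0] const[of 0] by simp

lemma triangle:
  assumes "Z \<in> \<H>" "X \<in> \<H>" "Y \<in> \<H>" "\<And>\<omega>. \<omega> \<in> \<Omega> \<Longrightarrow> Z \<omega> \<le> X \<omega> + Y \<omega>"
  shows "E Z \<le> E X + E Y"
  using mono[OF assms(1) add_in[OF assms(2,3)] assms(4)] add_le[OF assms(2,3)] by simp

text \<open>
  Since \<open>E\<close> is not linear, the lower bound on \<open>E X\<close> needs its own argument: \<open>0 \<le> Y + X\<close> gives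
  \<open>0 \<le> E Y + E X\<close>.
\<close>

lemma abs_le:
  assumes "X \<in> \<H>" "Y \<in> \<H>" "\<And>\<omega>. \<omega> \<in> \<Omega> \<Longrightarrow> \<bar>X \<omega>\<bar> \<le> Y \<omega>"
  shows "\<bar>E X\<bar> \<le> E Y"
proof -
  have "E X \<le> E Y"
    by (rule mono) (use assms in \<open>auto intro: order_trans[OF abs_ge_self]\<close>)
  moreover have "E (\<lambda>_. 0) \<le> E Y + E X"
    by (rule triangle) (use assms in \<open>force intro: const_in\<close>)+
  ultimately show ?thesis
    using const[of 0] by simp
qed

end

locale path_expectation = sublinear_expectation "path_space T" "H0 T" E
  for T :: real and E :: "(path \<Rightarrow> real) \<Rightarrow> real" +
  assumes T_pos: "0 < T"
begin

lemma abs_diff_in: "X \<in> H0 T \<Longrightarrow> Y \<in> H0 T \<Longrightarrow> (\<lambda>\<omega>. \<bar>X \<omega> - Y \<omega>\<bar>) \<in> H0 T"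
  by (intro H0_abs diff_in)

lemma abs_E_diff_le:
  assumes "X \<in> H0 T" "Y \<in> H0 T"
  shows "\<bar>E X - E Y\<bar> \<le> dist_L1 E X Y"
proof -
  have "E X \<le> E (\<lambda>\<omega>. \<bar>X \<omega> - Y \<omega>\<bar>) + E Y" "E Y \<le> E (\<lambda>\<omega>. \<bar>X \<omega> - Y \<omega>\<bar>) + E X"
    by (rule triangle; use assms in \<open>auto intro: abs_diff_in\<close>)+
  then show ?thesis
    by (simp add: dist_L1_def)
qed

lemma pseudometric_L1: "pseudometric_on (H0 T) (dist_L1 E)"
  unfolding pseudometric_on_def
proof (intro conjI ballI)
  fix X Y Z assume XYZ: "X \<in> H0 T" "Y \<in> H0 T" "Z \<in> H0 T"
  show "dist_L1 E X X = 0" by (simp add: dist_L1_def const)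
  show "0 \<le> dist_L1 E X Y"
    unfolding dist_L1_def using XYZ by (intro nonneg abs_diff_in) auto
  show "dist_L1 E X Y = dist_L1 E Y X"
    by (simp add: dist_L1_def abs_minus_commute)
  show "dist_L1 E X Z \<le> dist_L1 E X Y + dist_L1 E Y Z"
    unfolding dist_L1_def by (rule triangle) (use XYZ in \<open>auto intro: abs_diff_in\<close>)
qed

text \<open>
  Along each path the integral is a sum over pairs of cells of \<open>g(\<zeta>\<^sub>j, \<rho>\<^sub>k)\<close>, weighted by the
  deterministic lengths of their intersections.
  It is applied to \<open>g(x, y) = x\<close>, for integrals of processes, and to \<open>g(x, y) = \<bar>x - y\<bar>\<close>, for
  distances.
\<close>

lemma integral_pair_in_H0:
  fixes g :: "real \<Rightarrow> real \<Rightarrow> real"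
  assumes "\<eta> \<in> M0_G T" "\<theta> \<in> M0_G T" "g 0 0 = 0"
    and g: "\<And>X Y. X \<in> H0 T \<Longrightarrow> Y \<in> H0 T \<Longrightarrow> (\<lambda>\<omega>. g (X \<omega>) (Y \<omega>)) \<in> H0 T"
  shows "(\<lambda>\<omega>. integral {0..T} (\<lambda>s. g (\<eta> s \<omega>) (\<theta> s \<omega>))) \<in> H0 T"
proof -
  obtain N t \<zeta> where "represents T N t \<zeta> \<eta>"
    using assms(1) unfolding M0_G_iff by blast
  note t = representsD(1)[OF this] and \<zeta> = representsD(2)[OF this] and \<eta> = representsD(3)[OF this]
  obtain M u \<rho> where "represents T M u \<rho> \<theta>"
    using assms(2) unfolding M0_G_iff by blast
  note u = representsD(1)[OF this] and \<rho> = representsD(2)[OF this] and \<theta> = representsD(3)[OF this]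
  have in_H0: "\<zeta> j \<in> H0 T" "\<rho> k \<in> H0 T" if "j < N" "k < M" for j k
    using that Lip_imp_H0[OF \<zeta>] Lip_imp_H0[OF \<rho>] partition_bounds(2)[OF t, of j]
      partition_bounds(2)[OF u, of k] by auto
  let ?S = "\<lambda>\<omega>. \<Sum>j<N. \<Sum>k<M. overlap (t j) (t (Suc j)) (u k) (u (Suc k)) * g (\<zeta> j \<omega>) (\<rho> k \<omega>)"
  have "(\<lambda>\<omega>. g (\<zeta> j \<omega>) (\<rho> k \<omega>)) \<in> H0 T" if "j < N" "k < M" for j k
    using g[OF in_H0[OF that]] .
  then have "?S \<in> H0 T"
    by (intro sum_in scale_in) auto
  moreover have "?S \<omega> = integral {0..T} (\<lambda>s. g (\<eta> s \<omega>) (\<theta> s \<omega>))" if "\<omega> \<in> path_space T" for \<omega>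
  proof -
    have "integral {0..T} (\<lambda>s. g (\<eta> s \<omega>) (\<theta> s \<omega>)) =
        integral {0..T} (\<lambda>s. g (step_fun N t (\<lambda>j. \<zeta> j \<omega>) s) (step_fun M u (\<lambda>j. \<rho> j \<omega>) s))"
      by (intro integral_cong) (simp only: \<eta>[OF _ that] \<theta>[OF _ that])
    also have "\<dots> = (\<Sum>j<N. \<Sum>k<M. g (\<zeta> j \<omega>) (\<rho> k \<omega>) * overlap (t j) (t (Suc j)) (u k) (u (Suc k)))"
      by (rule integral_unique, rule has_integral_combined_step_funs
          [OF t u, where g = g and c = "\<lambda>j. \<zeta> j \<omega>" and d = "\<lambda>k. \<rho> k \<omega>"]) (fact assms)
    also have "\<dots> = ?S \<omega>"
      by (simp only: mult.commute)
    finally show ?thesis ..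
  qed
  ultimately show ?thesis
    by (rule cong_closed)
qed

lemma integral_in_H0: "\<eta> \<in> M0_G T \<Longrightarrow> (\<lambda>\<omega>. integral {0..T} (\<lambda>s. \<eta> s \<omega>)) \<in> H0 T"
  using integral_pair_in_H0[of \<eta> \<eta> "\<lambda>x y. x"] by simp

lemma integral_abs_diff_in_H0:
  "\<eta> \<in> M0_G T \<Longrightarrow> \<theta> \<in> M0_G T \<Longrightarrow> (\<lambda>\<omega>. integral {0..T} (\<lambda>s. \<bar>\<eta> s \<omega> - \<theta> s \<omega>\<bar>)) \<in> H0 T"
  using integral_pair_in_H0[of \<eta> \<theta> "\<lambda>x y. \<bar>x - y\<bar>"] abs_diff_in by simp

lemma abs_diff_integrable:
  "\<eta> \<in> M0_G T \<Longrightarrow> \<theta> \<in> M0_G T \<Longrightarrow> \<omega> \<in> path_space T \<Longrightarrow>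
    (\<lambda>s. \<bar>\<eta> s \<omega> - \<theta> s \<omega>\<bar>) integrable_on {0..T}"
  using M0_G_pair_integrable[of \<eta> T \<theta> \<omega> "\<lambda>x y. \<bar>x - y\<bar>"] by simp

lemma pseudometric_M1: "pseudometric_on (M0_G T) (dist_M1 T E)"
  unfolding pseudometric_on_def
proof (intro conjI ballI)
  fix \<eta> \<theta> \<kappa> assume M0: "\<eta> \<in> M0_G T" "\<theta> \<in> M0_G T" "\<kappa> \<in> M0_G T"
  show "dist_M1 T E \<eta> \<eta> = 0" by (simp add: dist_M1_def const)
  show "0 \<le> dist_M1 T E \<eta> \<theta>"
    unfolding dist_M1_def
    by (rule nonneg[OF integral_abs_diff_in_H0[OF M0(1,2)]])
      (rule integral_nonneg[OF abs_diff_integrable[OF M0(1,2)]], auto)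
  show "dist_M1 T E \<eta> \<theta> = dist_M1 T E \<theta> \<eta>"
    by (simp add: dist_M1_def abs_minus_commute)
  show "dist_M1 T E \<eta> \<kappa> \<le> dist_M1 T E \<eta> \<theta> + dist_M1 T E \<theta> \<kappa>"
    unfolding dist_M1_def
  proof (rule triangle)
    fix \<omega> assume \<omega>: "\<omega> \<in> path_space T"
    note int = abs_diff_integrable[OF M0(1) M0(3) \<omega>] abs_diff_integrable[OF M0(1) M0(2) \<omega>]
      abs_diff_integrable[OF M0(2) M0(3) \<omega>]
    have "integral {0..T} (\<lambda>s. \<bar>\<eta> s \<omega> - \<kappa> s \<omega>\<bar>)
        \<le> integral {0..T} (\<lambda>s. \<bar>\<eta> s \<omega> - \<theta> s \<omega>\<bar> + \<bar>\<theta> s \<omega> - \<kappa> s \<omega>\<bar>)"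
      by (rule integral_le[OF int(1) integrable_add[OF int(2,3)]]) simp
    also have "\<dots> = integral {0..T} (\<lambda>s. \<bar>\<eta> s \<omega> - \<theta> s \<omega>\<bar>) +
        integral {0..T} (\<lambda>s. \<bar>\<theta> s \<omega> - \<kappa> s \<omega>\<bar>)"
      by (rule integral_add[OF int(2,3)])
    finally show "integral {0..T} (\<lambda>s. \<bar>\<eta> s \<omega> - \<kappa> s \<omega>\<bar>)
        \<le> integral {0..T} (\<lambda>s. \<bar>\<eta> s \<omega> - \<theta> s \<omega>\<bar>) + integral {0..T} (\<lambda>s. \<bar>\<theta> s \<omega> - \<kappa> s \<omega>\<bar>)" .
  qed (rule integral_abs_diff_in_H0; fact)+
qed

lemma integral_Lipschitz:
  assumes M0: "\<eta> \<in> M0_G T" "\<theta> \<in> M0_G T"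
  shows "dist_L1 E (\<lambda>\<omega>. integral {0..T} (\<lambda>s. \<eta> s \<omega>)) (\<lambda>\<omega>. integral {0..T} (\<lambda>s. \<theta> s \<omega>))
    \<le> dist_M1 T E \<eta> \<theta>"
  unfolding dist_L1_def dist_M1_def
proof (rule mono)
  fix \<omega> assume \<omega>: "\<omega> \<in> path_space T"
  have int: "(\<lambda>s. \<eta> s \<omega>) integrable_on {0..T}" "(\<lambda>s. \<theta> s \<omega>) integrable_on {0..T}"
    using M0_G_pair_integrable[OF M0 \<omega>, of "\<lambda>x y. x"] M0_G_pair_integrable[OF M0 \<omega>, of "\<lambda>x y. y"]
    by simp_all
  have "\<bar>integral {0..T} (\<lambda>s. \<eta> s \<omega> - \<theta> s \<omega>)\<bar> \<le> integral {0..T} (\<lambda>s. \<bar>\<eta> s \<omega> - \<theta> s \<omega>\<bar>)"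
    using integral_norm_bound_integral[OF integrable_diff[OF int] abs_diff_integrable[OF M0 \<omega>]]
    by simp
  then show "\<bar>integral {0..T} (\<lambda>s. \<eta> s \<omega>) - integral {0..T} (\<lambda>s. \<theta> s \<omega>)\<bar>
      \<le> integral {0..T} (\<lambda>s. \<bar>\<eta> s \<omega> - \<theta> s \<omega>\<bar>)"
    by (simp add: integral_diff int)
qed (rule abs_diff_in[OF M0[THEN integral_in_H0]] integral_abs_diff_in_H0[OF M0])+

lemma mult_Lipschitz:
  assumes u: "time_partition T M u" and d: "\<And>k. k < M \<Longrightarrow> \<bar>d k\<bar> \<le> 1"
    and M0: "\<eta> \<in> M0_G T" "\<theta> \<in> M0_G T"
  shows "dist_M1 T E (\<lambda>s \<omega>. step_fun M u d s * \<eta> s \<omega>) (\<lambda>s \<omega>. step_fun M u d s * \<theta> s \<omega>)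
    \<le> dist_M1 T E \<eta> \<theta>"
proof -
  note hM0 = M0_G_step_mult[OF T_pos u, of _ d]
  show ?thesis
    unfolding dist_M1_def
  proof (rule mono)
    fix \<omega> assume \<omega>: "\<omega> \<in> path_space T"
    show "integral {0..T} (\<lambda>s. \<bar>step_fun M u d s * \<eta> s \<omega> - step_fun M u d s * \<theta> s \<omega>\<bar>)
        \<le> integral {0..T} (\<lambda>s. \<bar>\<eta> s \<omega> - \<theta> s \<omega>\<bar>)"
    proof (rule integral_le)
      fix s assume "s \<in> {0..T}"
      then have "\<bar>step_fun M u d s\<bar> \<le> 1"
        using abs_step_fun_le[OF u d] by simp
      then show "\<bar>step_fun M u d s * \<eta> s \<omega> - step_fun M u d s * \<theta> s \<omega>\<bar> \<le> \<bar>\<eta> s \<omega> - \<theta> s \<omega>\<bar>"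
        by (simp add: right_diff_distrib[symmetric] abs_mult mult_left_le_one_le)
    qed (rule abs_diff_integrable[OF M0 \<omega>] abs_diff_integrable[OF M0[THEN hM0] \<omega>])+
  qed (rule integral_abs_diff_in_H0[OF M0] integral_abs_diff_in_H0[OF M0[THEN hM0]])+
qed

text \<open>
  Evaluates the chain of three continuous extensions on a representative, so that everything
  else can be done with simple processes.
\<close>

lemma tendsto_E_integral_mult:
  assumes u: "time_partition T M u" and d: "\<And>k. k < M \<Longrightarrow> \<bar>d k\<bar> \<le> 1"
    and X: "X \<in> cauchy_seqs (M0_G T) (dist_M1 T E)"
  shows "(\<lambda>k. E (\<lambda>\<omega>. integral {0..T} (\<lambda>s. step_fun M u d s * X k s \<omega>))) \<longlonglongrightarrow>
    E_L1 E (integral_M1 T E (mult_M1 T E (step_fun M u d)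
      (null_rel (M0_G T) (dist_M1 T E) `` {X})))"
proof -
  let ?R = "null_rel (M0_G T) (dist_M1 T E)" and ?Q = "null_rel (H0 T) (dist_L1 E)"
  let ?hX = "\<lambda>k s \<omega>. step_fun M u d s * X k s \<omega>"
  let ?I = "\<lambda>k \<omega>. integral {0..T} (\<lambda>s. ?hX k s \<omega>)"
  let ?h = "\<lambda>\<eta> s (\<omega>::path). step_fun M u d s * \<eta> s \<omega>"
  have h: "?h \<eta> \<in> M0_G T" if "\<eta> \<in> M0_G T" for \<eta>
    by (rule M0_G_step_mult[OF T_pos u that])
  have h_lip: "dist_M1 T E (?h \<eta>) (?h \<theta>) \<le> dist_M1 T E \<eta> \<theta>" if "\<eta> \<in> M0_G T" "\<theta> \<in> M0_G T" for \<eta> \<theta>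
    by (rule mult_Lipschitz[OF u d that])
  have hX_eq: "mult_M1 T E (step_fun M u d) (?R `` {X}) = ?R `` {?hX}"
    unfolding mult_M1_def
    by (rule completion_map_class(1)[where f = ?h, OF pseudometric_M1 pseudometric_M1 h h_lip X])
  have Cauchy_hX: "?hX \<in> cauchy_seqs (M0_G T) (dist_M1 T E)"
    by (rule cauchy_seqs_image[where f = ?h, OF X h h_lip])
  let ?int = "\<lambda>\<eta> (\<omega>::path). integral {0..T} (\<lambda>s. \<eta> s \<omega>)"
  have I_eq: "integral_M1 T E (?R `` {?hX}) = ?Q `` {?I}"
    unfolding integral_M1_def
    by (rule completion_map_class(1)[where f = ?int,
          OF pseudometric_M1 pseudometric_L1 integral_in_H0 integral_Lipschitz Cauchy_hX])
  have "?I \<in> cauchy_seqs (H0 T) (dist_L1 E)"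
    by (rule cauchy_seqs_image[where f = ?int, OF Cauchy_hX integral_in_H0 integral_Lipschitz])
  from completion_functional_class[OF pseudometric_L1 abs_E_diff_le this]
  show ?thesis
    unfolding hX_eq I_eq E_L1_def .
qed


section \<open>Convergence for a fixed process and for a limit of processes\<close>

text \<open>
  The oscillation bound holds along every path with the coefficients of the process in place of
  the constants, so taking expectations leaves the factor \<open>1 / n\<close> in front of the expectation of
  one fixed random variable.
\<close>

lemma abs_E_integral_\<delta>_le:
  assumes "\<eta> \<in> M0_G T"
  obtains C where "\<And>n. 0 < n \<Longrightarrow> \<bar>E (\<lambda>\<omega>. integral {0..T} (\<lambda>s. \<delta> T n s * \<eta> s \<omega>))\<bar> \<le> C / real n"
proof -
  obtain N t \<zeta> where "represents T N t \<zeta> \<eta>"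
    using assms(1) unfolding M0_G_iff by blast
  note t = representsD(1)[OF this] and \<zeta> = representsD(2)[OF this] and \<eta> = representsD(3)[OF this]
  let ?Z = "\<lambda>\<omega>. \<Sum>j<N. \<bar>\<zeta> j \<omega>\<bar>"
  have Z: "?Z \<in> H0 T"
    using Lip_imp_H0[OF \<zeta>] partition_bounds(2)[OF t] by (intro sum_in H0_abs) auto
  have "\<bar>E (\<lambda>\<omega>. integral {0..T} (\<lambda>s. \<delta> T n s * \<eta> s \<omega>))\<bar> \<le> (T * E ?Z) / real n" if n: "0 < n" for n
  proof -
    have "\<bar>E (\<lambda>\<omega>. integral {0..T} (\<lambda>s. \<delta> T n s * \<eta> s \<omega>))\<bar> \<le> E (\<lambda>\<omega>. (T / real n) * ?Z \<omega>)"
    proof (rule abs_le)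
      show "(\<lambda>\<omega>. integral {0..T} (\<lambda>s. \<delta> T n s * \<eta> s \<omega>)) \<in> H0 T"
        unfolding \<delta>_eq_step_fun
        by (intro integral_in_H0 M0_G_step_mult T_pos partition_uniform n assms)
      show "(\<lambda>\<omega>. (T / real n) * ?Z \<omega>) \<in> H0 T"
        using Z by (rule scale_in)
      fix \<omega> assume "\<omega> \<in> path_space T"
      then have "integral {0..T} (\<lambda>s. \<delta> T n s * \<eta> s \<omega>) =
          integral {0..T} (\<lambda>s. \<delta> T n s * step_fun N t (\<lambda>j. \<zeta> j \<omega>) s)"
        by (intro integral_cong) (simp only: \<eta>)
      then show "\<bar>integral {0..T} (\<lambda>s. \<delta> T n s * \<eta> s \<omega>)\<bar> \<le> (T / real n) * ?Z \<omega>"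
        using abs_integral_\<delta>_step_fun_le[OF T_pos n t] by simp
    qed
    also have "\<dots> = (T / real n) * E ?Z"
      using Z T_pos by (intro pos_homogeneous) auto
    finally show ?thesis by simp
  qed
  then show ?thesis by (rule that)
qed

text \<open>
  The member \<open>X K\<close> of the representing sequence serves as the approximating simple process.  It is
  chosen before \<open>n\<close>, which is possible because the Lipschitz constant 1 is the same for all \<open>n\<close>.
\<close>

lemma E_integral_\<delta>_tendsto_zero:
  assumes X: "X \<in> cauchy_seqs (M0_G T) (dist_M1 T E)"
  shows "(\<lambda>n. E_L1 E (integral_M1 T E (mult_M1 T E (\<delta> T n)
    (null_rel (M0_G T) (dist_M1 T E) `` {X})))) \<longlonglongrightarrow> 0"
    (is "?a \<longlonglongrightarrow> 0")
proof (rule LIMSEQ_I)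
  fix e :: real assume "e > 0"
  let ?F = "\<lambda>n k. E (\<lambda>\<omega>. integral {0..T} (\<lambda>s. \<delta> T n s * X k s \<omega>))"
  note M0 = cauchy_seqs_in[OF X]
  obtain K where K: "dist_M1 T E (X k) (X K) < e / 2" if "k \<ge> K" for k
    using cauchy_seqsD[OF X, of "e / 2"] \<open>e > 0\<close> by auto
  obtain C where C: "\<bar>?F n K\<bar> \<le> C / real n" if "0 < n" for n
    using abs_E_integral_\<delta>_le[OF M0[of K]] by blast
  have bound: "\<bar>?a n\<bar> \<le> e / 2 + C / real n" if n: "0 < n" for n
  proof -
    note u = partition_uniform[OF T_pos n]
    have lim: "(\<lambda>k. ?F n k) \<longlonglongrightarrow> ?a n"
      unfolding \<delta>_eq_step_fun by (rule tendsto_E_integral_mult[OF u _ X]) (simp add: power_abs)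
    have "\<bar>?F n k\<bar> \<le> e / 2 + C / real n" if "k \<ge> K" for k
    proof -
      note hM0 = M0_G_step_mult[OF T_pos u M0, of "\<lambda>i. (-1) ^ i", folded \<delta>_eq_step_fun]
      have "\<bar>?F n k - ?F n K\<bar> \<le> dist_L1 E (\<lambda>\<omega>. integral {0..T} (\<lambda>s. \<delta> T n s * X k s \<omega>))
          (\<lambda>\<omega>. integral {0..T} (\<lambda>s. \<delta> T n s * X K s \<omega>))"
        by (intro abs_E_diff_le integral_in_H0 hM0)
      also have "\<dots> \<le> dist_M1 T E (\<lambda>s \<omega>. \<delta> T n s * X k s \<omega>) (\<lambda>s \<omega>. \<delta> T n s * X K s \<omega>)"
        by (intro integral_Lipschitz hM0)
      also have "\<dots> \<le> dist_M1 T E (X k) (X K)"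
        unfolding \<delta>_eq_step_fun by (rule mult_Lipschitz[OF u _ M0 M0]) (simp add: power_abs)
      finally show ?thesis
        using K[OF that] C[OF n] by linarith
    qed
    then show ?thesis
      by (intro LIMSEQ_le_const2[OF tendsto_rabs[OF lim]]) blast
  qed
  have "(\<lambda>n. C / real n) \<longlonglongrightarrow> 0"
    by (rule lim_const_over_n)
  from LIMSEQ_D[OF this, of "e / 2"] \<open>e > 0\<close>
  obtain n0 where n0: "\<bar>C / real n\<bar> < e / 2" if "n \<ge> n0" for n
    unfolding diff_zero real_norm_def by (metis half_gt_zero)
  have "norm (?a n - 0) < e" if "n \<ge> Suc n0" for n
    using bound[of n] n0[of n] that unfolding diff_zero real_norm_def by linarith
  then show "\<exists>n0. \<forall>n\<ge>n0. norm (?a n - 0) < e"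
    by blast
qed

end

theorem theorem3p4:
  fixes T \<sigma>_low \<sigma>_up :: real
    and E :: "(path \<Rightarrow> real) \<Rightarrow> real"
    and \<Omega>' :: "'w set" and \<H>' :: "('w \<Rightarrow> real) set" and E' :: "('w \<Rightarrow> real) \<Rightarrow> real"
    and \<xi> :: "nat \<Rightarrow> 'w \<Rightarrow> real"
    and \<eta> :: "(nat \<Rightarrow> real \<Rightarrow> path \<Rightarrow> real) set"
  assumes "0 < T"
    and "0 \<le> \<sigma>_low\<^sup>2" and "\<sigma>_low\<^sup>2 < \<sigma>_up\<^sup>2"
    and "G_expectation T E \<Omega>' \<H>' E' \<xi> \<sigma>_low \<sigma>_up"
    and "\<eta> \<in> M1_G T E"
  shows "(\<lambda>n. E_L1 E (integral_M1 T E (mult_M1 T E (\<delta> T n) \<eta>))) \<longlonglongrightarrow> 0"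
proof -
  interpret G: G_expectation T E \<Omega>' \<H>' E' \<xi> \<sigma>_low \<sigma>_up
    by (fact assms)
  interpret path_expectation T E
    by unfold_locales (fact assms)
  obtain X where "X \<in> cauchy_seqs (M0_G T) (dist_M1 T E)"
    "\<eta> = null_rel (M0_G T) (dist_M1 T E) `` {X}"
    using assms(5) unfolding M1_G_def completion_def by (rule quotientE)
  then show ?thesis
    using E_integral_\<delta>_tendsto_zero by simp
qed

end
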